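(* Let $\Lambda$ be a symplectic lattice of type $(d_1,\dots,d_g)$ with $d_1=d_2=1$. A primitive vector $v\in\Lambda$ is splitting if and only if the element $[v^\ast]\in D_\Lambda$ is splitting. Consequently $v\mapsto[v^\ast]$ defines a bijection $$\{\, v\in\Lambda \mid v \text{ splitting}\,\}/\Gamma_\Lambda \longrightarrow \{\, x\in D_\Lambda \mid x \text{ splitting}\,\}.$$
   Context: A symplectic lattice is a free $\mathbb{Z}$-module $\Lambda$ of rank $2g$ with a nondegenerate alternating bilinear form $(\cdot,\cdot)\colon\Lambda\times\Lambda\to\mathbb{Z}$. Let $U$ be the rank-2 lattice with Gram matrix $\begin{pmatrix}0&1\\-1&0\end{pmatrix}$ and $U(d)$ its form scaled by $d$. Every symplectic lattice is isometric to $U(d_1)\oplus\cdots\oplus U(d_g)$ with $d_i\mid d_{i+1}$; $(d_1,\dots,d_g)$ is its type. $\Lambda^\vee=\{v\in\Lambda\otimes\mathbb{Q}\mid (v,\Lambda)\subset\mathbb{Z}\}$, $D_\Lambda=\Lambda^\vee/\Lambda$ with the induced nondegenerate form $D_\Lambda\times D_\Lambda\to\mathbb{Q}/\mathbb{Z}$. $\Gamma_\Lambda$ is the kernel of $\mathrm{Sp}(\Lambda)\to\mathrm{Sp}(D_\Lambda)$ (isometry groups). A vector $v$ is primitive if $\mathbb{Q}v\cap\Lambda=\mathbb{Z}v$; then $\mathrm{div}(v)>0$ is defined by $(v,\Lambda)=\mathrm{div}(v)\mathbb{Z}$, $v^\ast=v/\mathrm{div}(v)$, and $[v^\ast]$ is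 its class in $D_\Lambda$. A primitive $v\in\Lambda$ is splitting if it lies in a rank-2 sublattice $\Lambda_1$ with $\Lambda=\Lambda_1\oplus\Lambda_1^\perp$. An element $x\in D_\Lambda$ of order $d$ is splitting if there is $y\in D_\Lambda$ of order $d$ with $(x,y)=1/d\in\mathbb{Q}/\mathbb{Z}$ (equivalently, $x$ lies in a subgroup $D_1\cong(\mathbb{Z}/d)^{\oplus2}$ with $D_\Lambda=D_1\oplus D_1^\perp$). *)

theory Defs
  imports "HOL-Algebra.Group_Action" "HOL-Algebra.Multiplicative_Group"
begin

definition add_group_on :: "'a::ab_group_add set \<Rightarrow> 'a monoid" where
  "add_group_on A = \<lparr>carrier = A, mult = (+), one = 0\<rparr>"

definition isometry_group :: "('a, 'm) monoid_scheme \<Rightarrow> ('a \<Rightarrow> 'a \<Rightarrow> 'q) \<Rightarrow> ('a \<Rightarrow> 'a) monoid" where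
  "isometry_group G b = AutoGroup G
     \<lparr>carrier := {\<phi> \<in> auto G. \<forall>x\<in>carrier G. \<forall>y\<in>carrier G. b (\<phi> x) (\<phi> y) = b x y}\<rparr>"

text \<open>Elements of \<open>\<rat>/\<int>\<close> are represented by the cosets of \<open>\<int>\<close> in \<open>\<rat>\<close>.\<close>

definition rat_class :: "rat \<Rightarrow> rat set" where
  "rat_class q = \<int> #>\<^bsub>add_group_on UNIV\<^esub> q"

locale rational_space = vector_space scale
  for scale :: "rat \<Rightarrow> 'v::ab_group_add \<Rightarrow> 'v"
begin

sublocale Z: Modules.module "\<lambda>k::int. scale (of_int k)"
  by unfold_locales (simp_all add: algebra_simps)

definition free_of_rank :: "'v set \<Rightarrow> nat \<Rightarrow> bool" where
  "free_of_rank M n \<longleftrightarrow> (\<exists>S. finite S \<and> card S = n \<and> Z.independent S \<and> Z.span S = M)"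

end

text \<open>
  The ambient space plays the role of \<open>\<Lambda> \<otimes> \<rat>\<close>: it is a rational vector space
  containing \<open>\<Lambda>\<close> and spanned by it. Accordingly \<open>B\<close> is the bilinear extension to
  \<open>\<Lambda> \<otimes> \<rat>\<close> of the integer-valued form of \<open>\<Lambda>\<close>.
\<close>

locale symplectic_lattice = rational_space scale
  for scale :: "rat \<Rightarrow> 'v::ab_group_add \<Rightarrow> 'v" +
  fixes \<Lambda> :: "'v set" and B :: "'v \<Rightarrow> 'v \<Rightarrow> rat" and g :: nat
  assumes free: "free_of_rank \<Lambda> (2 * g)"
    and span_lattice: "span \<Lambda> = UNIV"
    and linear_left: "\<And>y. Vector_Spaces.linear scale (*) (\<lambda>x. B x y)"
    and linear_right: "\<And>x. Vector_Spaces.linear scale (*) (\<lambda>y. B x y)"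
    and integral: "\<And>x y. x \<in> \<Lambda> \<Longrightarrow> y \<in> \<Lambda> \<Longrightarrow> B x y \<in> \<int>"
    and alternating: "\<And>x. x \<in> \<Lambda> \<Longrightarrow> B x x = 0"
    and nondegenerate: "\<And>x. x \<in> \<Lambda> \<Longrightarrow> (\<And>y. y \<in> \<Lambda> \<Longrightarrow> B x y = 0) \<Longrightarrow> x = 0"
begin

text \<open>
  An isometry of \<open>\<Lambda>\<close> with \<open>U(d\<^sub>1) \<oplus> \<dots> \<oplus> U(d\<^sub>g)\<close> is the same as a basis
  \<open>e\<^sub>1, f\<^sub>1, \<dots>, e\<^sub>g, f\<^sub>g\<close> with the Gram matrix below; as all \<open>d\<^sub>i\<close> are nonzero,
  the Gram matrix also forces these \<open>2g\<close> vectors to be distinct. The list is indexed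
  from 0, so \<open>ds ! i\<close> is \<open>d\<^bsub>i+1\<^esub>\<close>.
\<close>

definition has_type :: "nat list \<Rightarrow> bool" where
  "has_type ds \<longleftrightarrow>
     length ds = g \<and>
     (\<forall>i<g. ds ! i > 0) \<and>
     (\<forall>i. Suc i < g \<longrightarrow> ds ! i dvd ds ! Suc i) \<and>
     (\<exists>e f.
        Z.independent (e ` {..<g} \<union> f ` {..<g}) \<and>
        Z.span (e ` {..<g} \<union> f ` {..<g}) = \<Lambda> \<and>
        (\<forall>i<g. \<forall>j<g. B (e i) (e j) = 0 \<and> B (f i) (f j) = 0 \<and>
           B (e i) (f j) = (if i = j then of_nat (ds ! i) else 0)))"

definition dual :: "'v set" where
  "dual = {x. \<forall>y\<in>\<Lambda>. B x y \<in> \<int>}"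

definition disc_group :: "'v set monoid" where
  "disc_group = add_group_on dual Mod \<Lambda>"

definition disc_class :: "'v \<Rightarrow> 'v set" where
  "disc_class x = \<Lambda> #>\<^bsub>add_group_on dual\<^esub> x"

text \<open>The union is over equal sets: \<open>rat_class (B x y)\<close> does not depend on the
  representatives \<open>x\<close>, \<open>y\<close> of the cosets \<open>X\<close>, \<open>Y\<close>.\<close>

definition disc_form :: "'v set \<Rightarrow> 'v set \<Rightarrow> rat set" where
  "disc_form X Y = (\<Union>x\<in>X. \<Union>y\<in>Y. rat_class (B x y))"

definition Sp_lattice :: "('v \<Rightarrow> 'v) monoid" where
  "Sp_lattice = isometry_group (add_group_on \<Lambda>) B"

definition Sp_disc :: "('v set \<Rightarrow> 'v set) monoid" where
  "Sp_disc = isometry_group disc_group disc_form"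

definition rational_extension :: "('v \<Rightarrow> 'v) \<Rightarrow> 'v \<Rightarrow> 'v" where
  "rational_extension \<gamma> = (THE h. Vector_Spaces.linear scale scale h \<and> (\<forall>x\<in>\<Lambda>. h x = \<gamma> x))"

definition induced :: "('v \<Rightarrow> 'v) \<Rightarrow> 'v set \<Rightarrow> 'v set" where
  "induced \<gamma> = (\<lambda>X\<in>carrier disc_group. rational_extension \<gamma> ` X)"

definition Gamma_group :: "('v \<Rightarrow> 'v) monoid" where
  "Gamma_group = Sp_lattice\<lparr>carrier := kernel Sp_lattice Sp_disc induced\<rparr>"

text \<open>Primitive vectors are nonzero by convention; otherwise the condition
  \<open>\<rat>v \<inter> \<Lambda> = \<int>v\<close> would admit \<open>v = 0\<close>, which has no divisibility.\<close>

definition primitive :: "'v \<Rightarrow> bool" where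
  "primitive v \<longleftrightarrow> v \<in> \<Lambda> \<and> v \<noteq> 0 \<and>
     range (\<lambda>q. scale q v) \<inter> \<Lambda> = range (\<lambda>k::int. scale (of_int k) v)"

definition divisibility :: "'v \<Rightarrow> nat" where
  "divisibility v = (THE d. d > 0 \<and> B v ` \<Lambda> = range (\<lambda>k::int. of_nat d * of_int k))"

definition star :: "'v \<Rightarrow> 'v" where
  "star v = scale (1 / of_nat (divisibility v)) v"

definition perp :: "'v set \<Rightarrow> 'v set" where
  "perp M = {w \<in> \<Lambda>. \<forall>u\<in>M. B u w = 0}"

definition splitting_vector :: "'v \<Rightarrow> bool" where
  "splitting_vector v \<longleftrightarrow> primitive v \<and>
     (\<exists>\<Lambda>\<^sub>1. \<Lambda>\<^sub>1 \<subseteq> \<Lambda> \<and> free_of_rank \<Lambda>\<^sub>1 2 \<and> v \<in> \<Lambda>\<^sub>1 \<and>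
        \<Lambda> = {u + w | u w. u \<in> \<Lambda>\<^sub>1 \<and> w \<in> perp \<Lambda>\<^sub>1} \<and> \<Lambda>\<^sub>1 \<inter> perp \<Lambda>\<^sub>1 = {0})"

definition splitting_element :: "'v set \<Rightarrow> bool" where
  "splitting_element X \<longleftrightarrow> X \<in> carrier disc_group \<and>
     (\<exists>Y\<in>carrier disc_group.
        group.ord disc_group Y = group.ord disc_group X \<and>
        disc_form X Y = rat_class (1 / of_nat (group.ord disc_group X)))"

end

end

theory Submission
  imports Defs
begin

text \<open>
  Write \<open>d\<close> for the divisibility of a primitive \<open>v\<close>; it is the order of \<open>[v\<^sup>*]\<close>. Both notions of splitting
  amount to the existence of \<open>w \<in> \<Lambda>\<close> with \<open>(v, w) = d\<close> and \<open>(w, \<Lambda>) \<subseteq> d\<int>\<close>: such a \<open>w\<close> completes \<open>v\<close> to a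
  basis of an orthogonal summand, and \<open>w / d\<close> is the partner of \<open>v\<^sup>*\<close> in the discriminant group.

  Transvections \<open>x \<mapsto> x + c (x, a) a\<close> with \<open>a \<in> \<Lambda>\<close> and \<open>c \<in> \<int>\<close> act trivially on the discriminant group. If
  \<open>z' - z \<in> \<Lambda>\<close> and \<open>(z, z') = \<plusminus>1\<close>, the transvection along \<open>z' - z\<close> with \<open>c = (z, z')\<close> maps \<open>z\<close> to \<open>z'\<close>.
  Using the two unimodular planes \<open>\<langle>e\<^sub>1, f\<^sub>1\<rangle>\<close> and \<open>\<langle>e\<^sub>2, f\<^sub>2\<rangle>\<close>, any two vectors \<open>v\<^sup>*\<close>, \<open>v'\<^sup>*\<close> that are congruent
  modulo \<open>\<Lambda>\<close> are joined by a chain of such steps through vectors \<open>e\<^sub>1 + k\<close> with \<open>k\<close> orthogonal to both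
  planes. Conversely, changing a representative \<open>x\<close> of a class by a multiple of \<open>e\<^sub>1\<close> so that \<open>(x, f\<^sub>1) = 1\<close>
  makes it \<open>v\<^sup>*\<close> for a primitive \<open>v\<close>.
\<close>

section \<open>Linear maps, rationals and integers\<close>

lemma linear_iff_additive_homogeneous:
  "Vector_Spaces.linear s1 s2 f \<longleftrightarrow> vector_space s1 \<and> vector_space s2 \<and>
    (\<forall>x y. f (x + y) = f x + f y) \<and> (\<forall>c x. f (s1 c x) = s2 c (f x))"
  by (auto simp: Vector_Spaces.linear_def module_hom_iff module_iff_vector_space)

lemma of_nat_divide_in_Ints_iff:
  assumes "d > 0"
  shows "(of_nat n / of_nat d :: rat) \<in> \<int> \<longleftrightarrow> d dvd n"
  using of_int_div_of_int_in_Ints_iff[of "int n" "int d", where 'a = rat] assms by simp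

text \<open>The generator is the least positive integer in \<open>G\<close>: the remainder of any
  element modulo it again lies in \<open>G\<close> and is smaller, hence zero.\<close>

lemma int_subgroup_generator:
  fixes G :: "rat set"
  assumes ints: "G \<subseteq> \<int>" and diff: "\<And>x y. x \<in> G \<Longrightarrow> y \<in> G \<Longrightarrow> x - y \<in> G"
    and nonzero: "x \<in> G" "x \<noteq> 0"
  obtains d :: nat where "d > 0" "G = range (\<lambda>k::int. of_nat d * of_int k)"
proof -
  have zero: "0 \<in> G" using diff[OF nonzero(1) nonzero(1)] by simp
  have minus: "- y \<in> G" if "y \<in> G" for y using diff[OF zero that] by simp
  have add: "y + z \<in> G" if "y \<in> G" "z \<in> G" for y z using diff[OF that(1) minus[OF that(2)]] by simp
  have mult_nat: "of_nat n * y \<in> G" if "y \<in> G" for n :: nat and y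
    by (induction n) (auto simp: zero algebra_simps intro: add that)
  have mult: "of_int k * y \<in> G" if "y \<in> G" for k :: int and y
    using mult_nat[OF that, of "nat k"] minus[OF mult_nat[OF that, of "nat (- k)"]]
    by (cases "k \<ge> 0") auto
  define P where "P = (\<lambda>n::nat. n > 0 \<and> of_nat n \<in> G)"
  obtain m :: int where m: "x = of_int m" using ints nonzero(1) by (meson Ints_cases subsetD)
  have "P (nat \<bar>m\<bar>)" using nonzero m minus[OF nonzero(1)]
    by (auto simp: P_def abs_if)
  then have LP: "P (LEAST n. P n)" by (rule LeastI)
  define d where "d = (LEAST n. P n)"
  have d: "d > 0" "of_nat d \<in> G" using LP by (auto simp: P_def d_def)
  have "y \<in> range (\<lambda>k::int. of_nat d * of_int k)" if y: "y \<in> G" for y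
  proof -
    obtain b where b: "y = of_int b" using ints y by (meson Ints_cases subsetD)
    have "b = int d * (b div int d) + b mod int d" by simp
    then have eq: "y = of_nat d * of_int (b div int d) + of_int (b mod int d)"
      unfolding b by (metis of_int_add of_int_mult of_int_of_nat_eq)
    then have "of_int (b mod int d) \<in> G"
      using diff[OF y mult[OF d(2), of "b div int d"]] by (simp add: mult.commute)
    moreover have "nat (b mod int d) < d" using d(1) by (simp add: nat_less_iff)
    then have "\<not> P (nat (b mod int d))" unfolding d_def by (rule not_less_Least)
    moreover have "b mod int d \<ge> 0" using d(1) by simp
    ultimately have "b mod int d = 0" by (auto simp: P_def)
    then show ?thesis using eq by auto
  qed
  moreover have "of_nat d * of_int k \<in> G" for k :: int using mult[OF d(2), of k] by (simp add: mult.commute)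
  ultimately have "G = range (\<lambda>k::int. of_nat d * of_int k)" by blast
  with d(1) show ?thesis by (rule that)
qed

text \<open>Applied to the pairings of a vector with a unimodular plane, this yields a vector of the
  plane orthogonal to it, together with a partner of that vector. The pair \<open>a'\<close>,
  \<open>b'\<close> is \<open>a\<close>, \<open>b\<close> divided by the gcd; if both vanish, any
  coprime pair serves.\<close>

lemma int_bezout_pair:
  fixes a b :: int
  obtains a' b' u v where "a * b' = b * a'" "u * a' + v * b' = 1"
proof (cases "a = 0 \<and> b = 0")
  case True
  then show ?thesis using that[of 0 1 1 0] by simp
next
  case False
  then obtain a' b' where ab: "a = a' * gcd a b" "b = b' * gcd a b" "coprime a' b'"
    using gcd_coprime_exists[of a b] by auto
  obtain u v where "u * a' + v * b' = 1" using bezout_int[of a' b'] ab(3) by auto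
  moreover have "a * b' = b * a'" by (subst (1) ab(1), subst (2) ab(2)) (simp add: mult_ac)
  ultimately show ?thesis using that by blast
qed

context rational_space
begin

text \<open>Additivity gives compatibility with integers. For \<open>c = a / b\<close> the value at
  \<open>scale c x\<close> is then forced, since scaling by \<open>b\<close> is invertible.\<close>

lemma additive_imp_linear:
  assumes add: "\<And>x y. f (x + y) = f x + f y"
  shows "Vector_Spaces.linear scale scale f"
proof -
  have zero: "f 0 = 0" using add[of 0 0] by simp
  have minus: "f (- x) = - f x" for x using add[of x "- x"] zero by (simp add: minus_unique)
  have nat: "f (scale (of_nat n) x) = scale (of_nat n) (f x)" for n x
    by (induction n) (simp_all add: zero add scale_left_distrib)
  have int: "f (scale (of_int k) x) = scale (of_int k) (f x)" for k x
    using nat[of "nat k" x] nat[of "nat (- k)" x] minus[of "scale (of_int k) x"]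
    by (cases "k \<ge> 0") auto
  have "f (scale c x) = scale c (f x)" for c x
  proof -
    obtain a b where ab: "quotient_of c = (a, b)" by fastforce
    have b: "b > 0" and c: "c = of_int a / of_int b"
      using quotient_of_denom_pos[OF ab] quotient_of_div[OF ab] by auto
    have "scale (of_int b) (f (scale c x)) = scale (of_int a) (f x)"
      using b unfolding int[symmetric] by (simp add: c)
    then have "scale (1 / of_int b) (scale (of_int b) (f (scale c x)))
        = scale (1 / of_int b) (scale (of_int a) (f x))" by (rule arg_cong)
    then show ?thesis using b by (simp add: c)
  qed
  then show ?thesis by (simp add: linear_iff_additive_homogeneous add vector_space_axioms)
qed

end

declare Ints_of_int [intro] Ints_of_nat [intro]

context symplectic_lattice
begin

subsection \<open>Bilinear form, lattice and dual\<close>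

lemma B_add_left [simp]: "B (x + y) z = B x z + B y z"
  using linear_left[of z] by (auto simp: linear_iff_additive_homogeneous)
lemma B_add_right [simp]: "B x (y + z) = B x y + B x z"
  using linear_right[of x] by (auto simp: linear_iff_additive_homogeneous)
lemma B_scale_left [simp]: "B (scale q x) z = q * B x z"
  using linear_left[of z] by (auto simp: linear_iff_additive_homogeneous)
lemma B_scale_right [simp]: "B x (scale q z) = q * B x z"
  using linear_right[of x] by (auto simp: linear_iff_additive_homogeneous)
lemma B_zero_left [simp]: "B 0 z = 0"
  using B_scale_left[of 0 0 z] by simp
lemma B_zero_right [simp]: "B z 0 = 0"
  using B_scale_right[of z 0 0] by simp
lemma B_minus_left [simp]: "B (- x) z = - B x z"
  using B_add_left[of x "- x" z] by simp
lemma B_minus_right [simp]: "B x (- z) = - B x z"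
  using B_add_right[of x z "- z"] by simp
lemma B_diff_left [simp]: "B (x - y) z = B x z - B y z"
  using B_add_left[of x "- y" z] by simp
lemma B_diff_right [simp]: "B x (y - z) = B x y - B x z"
  using B_add_right[of x y "- z"] by simp

lemma subspace_lattice: "Z.subspace \<Lambda>"
  using free unfolding free_of_rank_def by auto

lemma lattice_add [intro]: "x \<in> \<Lambda> \<Longrightarrow> y \<in> \<Lambda> \<Longrightarrow> x + y \<in> \<Lambda>"
  using subspace_lattice by (rule Z.subspace_add)
lemma lattice_diff [intro]: "x \<in> \<Lambda> \<Longrightarrow> y \<in> \<Lambda> \<Longrightarrow> x - y \<in> \<Lambda>"
  using subspace_lattice by (rule Z.subspace_diff)
lemma lattice_zero [intro, simp]: "0 \<in> \<Lambda>"
  using subspace_lattice by (rule Z.subspace_0)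
lemma lattice_scale [intro]: "q \<in> \<int> \<Longrightarrow> x \<in> \<Lambda> \<Longrightarrow> scale q x \<in> \<Lambda>"
  using Z.subspace_scale[OF subspace_lattice, of x] by (auto elim!: Ints_cases)
lemma lattice_minus [intro]: "x \<in> \<Lambda> \<Longrightarrow> - x \<in> \<Lambda>"
  using subspace_lattice by (rule Z.subspace_neg)

text \<open>The denominators of a combination of lattice vectors are cleared one summand at a time.
  This transports identities from \<open>\<Lambda>\<close> to the whole rational space.\<close>

lemma multiple_in_lattice: "\<exists>N::nat. N > 0 \<and> scale (of_nat N) x \<in> \<Lambda>"
proof -
  have "x \<in> span \<Lambda>" using span_lattice by simp
  then show ?thesis
  proof (induction rule: span_induct_alt)
    case base
    show ?case by (auto intro!: exI[of _ 1])
  next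
    case (step c l y)
    then obtain N :: nat where N: "N > 0" "scale (of_nat N) y \<in> \<Lambda>" by blast
    obtain a b where ab: "quotient_of c = (a, b)" by fastforce
    have b: "b > 0" and c: "c = of_int a / of_int b"
      using quotient_of_denom_pos[OF ab] quotient_of_div[OF ab] by auto
    have "scale (of_nat (N * nat b)) (scale c l + y)
        = scale (of_int (int N * a)) l + scale (of_int b) (scale (of_nat N) y)"
      using b by (simp add: scale_right_distrib c mult.commute)
    also have "\<dots> \<in> \<Lambda>" using step(1) lattice_scale[OF _ N(2), of "of_int b"]
      by (intro lattice_add) (auto intro: lattice_scale simp del: scale_scale)
    finally show ?case using N b by (intro exI[of _ "N * nat b"]) auto
  qed
qed

lemma B_self [simp]: "B x x = 0"
proof -
  obtain N :: nat where "N > 0" "scale (of_nat N) x \<in> \<Lambda>" using multiple_in_lattice by blast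
  then show ?thesis using alternating[of "scale (of_nat N) x"] by simp
qed

lemma B_skew: "B x y = - B y x"
  using B_self[of "x + y"] by (simp del: B_self add: B_self[of x] B_self[of y])

lemma dual_iff: "x \<in> dual \<longleftrightarrow> (\<forall>y\<in>\<Lambda>. B x y \<in> \<int>)"
  by (simp add: dual_def)

lemma lattice_subset_dual: "x \<in> \<Lambda> \<Longrightarrow> x \<in> dual"
  using integral by (auto simp: dual_iff)

lemma dual_add [intro]: "x \<in> dual \<Longrightarrow> y \<in> dual \<Longrightarrow> x + y \<in> dual"
  by (auto simp: dual_iff)
lemma dual_minus [intro]: "x \<in> dual \<Longrightarrow> - x \<in> dual"
  by (auto simp: dual_iff)

lemma dual_congruent: "x \<in> dual \<Longrightarrow> y - x \<in> \<Lambda> \<Longrightarrow> y \<in> dual"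
  using dual_add[of x "y - x"] lattice_subset_dual[of "y - x"] by simp

subsection \<open>The discriminant group\<close>

lemma group_dual: "comm_group (add_group_on dual)"
  by (rule comm_groupI)
    (auto simp: add_group_on_def algebra_simps lattice_subset_dual intro!: bexI[of _ "- _"])

lemma normal_lattice: "\<Lambda> \<lhd> add_group_on dual"
proof -
  interpret comm_group "add_group_on dual" by (rule group_dual)
  have inv: "inv\<^bsub>add_group_on dual\<^esub> x = - x" if "x \<in> dual" for x
    using that by (intro inv_equality) (auto simp: add_group_on_def)
  have "subgroup \<Lambda> (add_group_on dual)"
    by (rule subgroupI)
      (use lattice_subset_dual inv in \<open>auto simp: add_group_on_def\<close>)
  then show ?thesis by (rule subgroup_imp_normal)
qed

lemma group_disc: "group disc_group"
  unfolding disc_group_def using normal_lattice by (rule normal.factorgroup_is_group)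

lemma in_disc_class_iff: "y \<in> disc_class x \<longleftrightarrow> y - x \<in> \<Lambda>"
  by (auto simp: disc_class_def r_coset_def add_group_on_def intro!: bexI[of _ "y - x"])

lemma disc_class_eq_iff: "disc_class x = disc_class y \<longleftrightarrow> y - x \<in> \<Lambda>"
proof
  show "y - x \<in> \<Lambda>" if "disc_class x = disc_class y"
    using that in_disc_class_iff[of y y] in_disc_class_iff[of y x] by simp
  assume *: "y - x \<in> \<Lambda>"
  have "z - x \<in> \<Lambda> \<longleftrightarrow> z - y \<in> \<Lambda>" for z
    using lattice_add[OF _ *, of "z - y"] lattice_diff[OF _ *, of "z - x"] by auto
  then show "disc_class x = disc_class y" by (auto simp: in_disc_class_iff)
qed

lemma carrier_disc: "carrier disc_group = disc_class ` dual"
  by (auto simp: disc_group_def FactGroup_def RCOSETS_def disc_class_def add_group_on_def)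

lemma disc_class_pow:
  "x \<in> dual \<Longrightarrow> disc_class x [^]\<^bsub>disc_group\<^esub> (n::nat) = disc_class (scale (of_nat n) x)"
proof (induction n)
  case 0
  interpret group disc_group by (rule group_disc)
  have "\<one>\<^bsub>disc_group\<^esub> = disc_class 0"
    by (auto simp: disc_group_def FactGroup_def in_disc_class_iff)
  then show ?case by simp
next
  case (Suc n)
  interpret group disc_group by (rule group_disc)
  have x: "scale (of_nat n) x \<in> dual" using Suc.prems by (auto simp: dual_iff)
  have "disc_class (scale (of_nat n) x) \<otimes>\<^bsub>disc_group\<^esub> disc_class x
      = disc_class (scale (of_nat n) x + x)"
    using normal.rcos_sum[OF normal_lattice, of "scale (of_nat n) x" x] x Suc.prems
    by (simp add: disc_group_def FactGroup_def disc_class_def add_group_on_def)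
  then show ?case using Suc by (simp add: algebra_simps)
qed

text \<open>The order is described by divisibility so that later equalities of orders reduce to
  \<open>dvd_antisym\<close>.\<close>

lemma ord_disc_class_dvd:
  assumes "x \<in> dual"
  shows "group.ord disc_group (disc_class x) dvd n \<longleftrightarrow> scale (of_nat n) x \<in> \<Lambda>"
proof -
  interpret group disc_group by (rule group_disc)
  have one: "\<one>\<^bsub>disc_group\<^esub> = disc_class 0"
    by (auto simp: disc_group_def FactGroup_def in_disc_class_iff)
  have "ord (disc_class x) dvd n \<longleftrightarrow> disc_class x [^]\<^bsub>disc_group\<^esub> n = \<one>\<^bsub>disc_group\<^esub>"
    using assms by (subst pow_eq_id) (auto simp: carrier_disc)
  also have "\<dots> \<longleftrightarrow> scale (of_nat n) x \<in> \<Lambda>"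
    unfolding one disc_class_pow[OF assms] using lattice_minus[of "scale (of_nat n) x"] 
       lattice_minus[of "- scale (of_nat n) x"]
    by (auto simp: disc_class_eq_iff)
  finally show ?thesis .
qed

text \<open>The value of \<open>ord\<close> is 0 on elements of infinite order; clearing
  denominators excludes that case here.\<close>

lemma ord_disc_class_pos:
  assumes "x \<in> dual"
  shows "group.ord disc_group (disc_class x) > 0"
  using multiple_in_lattice[of x] ord_disc_class_dvd[OF assms]
  by (metis dvd_0_left_iff gr0I)

lemma in_rat_class_iff: "p \<in> rat_class q \<longleftrightarrow> p - q \<in> \<int>"
  by (auto simp: rat_class_def r_coset_def add_group_on_def intro!: bexI[of _ "p - q"])

lemma rat_class_eq_iff: "rat_class p = rat_class q \<longleftrightarrow> p - q \<in> \<int>"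
proof
  show "p - q \<in> \<int>" if "rat_class p = rat_class q"
    using that in_rat_class_iff[of p p] in_rat_class_iff[of p q] by simp
  assume *: "p - q \<in> \<int>"
  have "r - p \<in> \<int> \<longleftrightarrow> r - q \<in> \<int>" for r
    using Ints_add[OF _ *, of "r - p"] Ints_diff[OF _ *, of "r - q"] by auto
  then show "rat_class p = rat_class q" by (auto simp: in_rat_class_iff)
qed

lemma disc_form_class:
  assumes "x \<in> dual" "y \<in> dual"
  shows "disc_form (disc_class x) (disc_class y) = rat_class (B x y)"
proof -
  have "rat_class (B x' y') = rat_class (B x y)"
    if "x' \<in> disc_class x" "y' \<in> disc_class y" for x' y'
  proof -
    have *: "x' - x \<in> \<Lambda>" "y' - y \<in> \<Lambda>" using that by (auto simp: in_disc_class_iff)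
    \<comment> \<open>Every term pairs a dual vector with a lattice vector or two lattice vectors,
      so the difference is integral.\<close>
    have "B x' y' - B x y = B x (y' - y) - B y (x' - x) + B (x' - x) (y' - y)"
      using B_skew[of y x] B_skew[of y x'] by simp
    also have "\<dots> \<in> \<int>" using assms * integral by (auto simp: dual_iff simp del: B_diff_left B_diff_right)
    finally show ?thesis by (simp add: rat_class_eq_iff)
  qed
  moreover have "x \<in> disc_class x" "y \<in> disc_class y" by (auto simp: in_disc_class_iff)
  ultimately show ?thesis unfolding disc_form_def by blast
qed

subsection \<open>Primitive vectors and divisibility\<close>

text \<open>Two positive generators of the same group of values divide each other, so the definite
  description has a unique solution.\<close>

lemma divisibility_eqI:
  assumes "d > 0" "B v ` \<Lambda> = range (\<lambda>k::int. of_nat d * of_int k)"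
  shows "divisibility v = d"
  unfolding divisibility_def
proof (rule the_equality)
  fix d' :: nat
  assume d': "d' > 0 \<and> B v ` \<Lambda> = range (\<lambda>k::int. of_nat d' * of_int k)"
  have dvd: "(a::nat) dvd b"
    if "range (\<lambda>k::int. (of_nat b :: rat) * of_int k) \<subseteq> range (\<lambda>k::int. of_nat a * of_int k)" for a b
  proof -
    have "(of_nat b :: rat) \<in> range (\<lambda>k::int. of_nat a * of_int k)"
      using that by (force intro: range_eqI[of _ _ 1])
    then obtain k :: int where "(of_nat b :: rat) = of_nat a * of_int k" by blast
    then have "(of_int (int b) :: rat) = of_int (int a * k)" by simp
    then have "int b = int a * k" by (simp only: of_int_eq_iff)
    then show ?thesis by (metis dvd_triv_left int_dvd_int_iff)
  qed
  show "d' = d" using d' assms dvd[of d d'] dvd[of d' d] by (simp add: dvd_antisym)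
qed (use assms in simp)

lemma divisibility:
  assumes "v \<in> \<Lambda>" "v \<noteq> 0"
  shows "divisibility v > 0" "B v ` \<Lambda> = range (\<lambda>k::int. of_nat (divisibility v) * of_int k)"
proof -
  obtain y where "y \<in> \<Lambda>" "B v y \<noteq> 0" using nondegenerate assms by blast
  then obtain d where d: "d > 0" "B v ` \<Lambda> = range (\<lambda>k::int. of_nat d * of_int k)"
    using int_subgroup_generator[of "B v ` \<Lambda>" "B v y"] integral[OF assms(1)]
    by (smt (verit, ccfv_SIG) B_diff_right image_iff image_subset_iff lattice_diff)
  then show "divisibility v > 0" "B v ` \<Lambda> = range (\<lambda>k::int. of_nat (divisibility v) * of_int k)"
    using divisibility_eqI[OF d] by auto
qed

lemma scale_divisibility_star:
  assumes "v \<in> \<Lambda>" "v \<noteq> 0"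
  shows "scale (of_nat (divisibility v)) (star v) = v"
  using divisibility(1)[OF assms] by (simp add: star_def)

lemma star_dual:
  assumes "v \<in> \<Lambda>" "v \<noteq> 0"
  shows "star v \<in> dual"
proof -
  have "B (star v) y \<in> \<int>" if y: "y \<in> \<Lambda>" for y
  proof -
    have "B v y \<in> range (\<lambda>k::int. of_nat (divisibility v) * of_int k)"
      using y by (simp flip: divisibility(2)[OF assms])
    then obtain k :: int where "B v y = of_nat (divisibility v) * of_int k" by blast
    then show ?thesis using divisibility(1)[OF assms] by (simp add: star_def)
  qed
  then show ?thesis by (simp add: dual_iff)
qed

text \<open>The divisibility is itself a value of \<open>B v\<close>. Being dual and taking the
  value 1 on \<open>\<Lambda>\<close> is all that the chains of transvections require of
  \<open>star v\<close>.\<close>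

lemma star_unimodular:
  assumes "v \<in> \<Lambda>" "v \<noteq> 0"
  shows "\<exists>y\<in>\<Lambda>. B (star v) y = 1"
proof -
  have "of_nat (divisibility v) \<in> B v ` \<Lambda>"
    unfolding divisibility(2)[OF assms] by (force intro: range_eqI[of _ _ 1])
  then show ?thesis using divisibility(1)[OF assms] by (force simp: star_def)
qed

lemma primitive_nonzero: "primitive v \<Longrightarrow> v \<in> \<Lambda>" "primitive v \<Longrightarrow> v \<noteq> 0"
  by (auto simp: primitive_def)

lemma primitive_scaleD:
  assumes "primitive v" "scale q v \<in> \<Lambda>"
  shows "q \<in> \<int>"
proof -
  have "scale q v \<in> range (\<lambda>k::int. scale (of_int k) v)" using assms by (auto simp: primitive_def)
  then show ?thesis using assms by (auto simp: primitive_def)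
qed

lemma primitiveI:
  assumes "v \<in> \<Lambda>" "v \<noteq> 0" "\<And>q. scale q v \<in> \<Lambda> \<Longrightarrow> q \<in> \<int>"
  shows "primitive v"
  using assms unfolding primitive_def by (fastforce elim: Ints_cases)

text \<open>A multiple \<open>n\<close> of \<open>star v\<close> is \<open>n / d\<close> times
  \<open>v\<close>, with \<open>d\<close> the divisibility; by primitivity it lies in
  \<open>\<Lambda>\<close> only if \<open>d\<close> divides \<open>n\<close>.\<close>

lemma ord_star:
  assumes "primitive v"
  shows "group.ord disc_group (disc_class (star v)) = divisibility v"
proof (rule dvd_antisym)
  note v = primitive_nonzero[OF assms]
  note ord = ord_disc_class_dvd[OF star_dual[OF v]]
  show "group.ord disc_group (disc_class (star v)) dvd divisibility v"
    using ord scale_divisibility_star v by simp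
  let ?n = "group.ord disc_group (disc_class (star v))"
  have "scale (of_nat ?n / of_nat (divisibility v)) v \<in> \<Lambda>"
    using ord[of ?n] by (simp add: star_def)
  then have "(of_nat ?n :: rat) / of_nat (divisibility v) \<in> \<int>" by (rule primitive_scaleD[OF assms])
  then show "divisibility v dvd ?n"
    using divisibility(1)[OF v] by (simp add: of_nat_divide_in_Ints_iff)
qed

section \<open>Splitting vectors and splitting elements\<close>

lemma perp_iff: "w \<in> perp M \<longleftrightarrow> w \<in> \<Lambda> \<and> (\<forall>u\<in>M. B u w = 0)"
  by (auto simp: perp_def)

lemma span_pair: "Z.span {s, t} = {scale (of_int a) s + scale (of_int b) t | a b. True}"
  by (auto simp: Z.span_insert Z.span_singleton algebra_simps)

text \<open>On a basis \<open>s\<close>, \<open>t\<close> of the summand the form is the determinant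
  times \<open>\<delta> = B s t\<close>. A primitive \<open>v\<close> has coprime coordinates, so
  some \<open>w\<close> in the summand has determinant 1 with it, and the divisibility is the
  absolute value of \<open>\<delta>\<close>.\<close>

lemma splitting_vector_partner:
  assumes "splitting_vector v"
  shows "\<exists>w\<in>\<Lambda>. B v w = of_nat (divisibility v) \<and> (\<forall>x\<in>\<Lambda>. B w x / of_nat (divisibility v) \<in> \<int>)"
proof -
  have prim: "primitive v" using assms by (simp add: splitting_vector_def)
  note v = primitive_nonzero[OF prim]
  obtain \<Lambda>\<^sub>1 where sub: "\<Lambda>\<^sub>1 \<subseteq> \<Lambda>" and free1: "free_of_rank \<Lambda>\<^sub>1 2" and vin: "v \<in> \<Lambda>\<^sub>1"
    and dec: "\<Lambda> = {u + w | u w. u \<in> \<Lambda>\<^sub>1 \<and> w \<in> perp \<Lambda>\<^sub>1}"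
    using assms unfolding splitting_vector_def by blast
  obtain s t where "Z.span {s, t} = \<Lambda>\<^sub>1"
    using free1 unfolding free_of_rank_def by (auto simp: card_2_iff)
  then have L1: "\<Lambda>\<^sub>1 = {scale (of_int a) s + scale (of_int b) t | a b. True}"
    by (simp add: span_pair)
  obtain a b where ab: "v = scale (of_int a) s + scale (of_int b) t" using vin L1 by auto
  define c where "c = gcd a b"
  have "c \<noteq> 0" using v ab by (auto simp: c_def)
  \<comment> \<open>Dividing \<open>v\<close> by the gcd of its coordinates stays inside the
    summand, so primitivity makes the gcd a unit.\<close>
  have "scale (1 / of_int c) v = scale (of_int (a div c)) s + scale (of_int (b div c)) t"
    using \<open>c \<noteq> 0\<close> unfolding ab
    by (simp add: scale_right_distrib c_def of_int_div)
  also have "\<dots> \<in> \<Lambda>\<^sub>1" using L1 by auto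
  finally have "(1 :: rat) / of_int c \<in> \<int>" using sub primitive_scaleD[OF prim] by blast
  then obtain k :: int where "(1 :: rat) / of_int c = of_int k" by (elim Ints_cases)
  then have "of_int (k * c) = (1 :: rat)" using \<open>c \<noteq> 0\<close> by (simp add: field_simps)
  then have "k * c = 1" by (simp only: of_int_eq_1_iff)
  then have "c dvd 1" by (metis dvd_triv_right)
  then have "gcd a b = 1" by (simp add: c_def)
  then obtain x y where xy: "x * a + y * b = 1" using bezout_int[of a b] by auto
  define \<delta> where "\<delta> = B s t"
  have ts: "B t s = - \<delta>" by (simp add: \<delta>_def B_skew[of t s])
  \<comment> \<open>The coordinates \<open>-y\<close>, \<open>x\<close> complete \<open>a\<close>,
    \<open>b\<close> to a matrix of determinant \<open>x * a + y * b = 1\<close>.\<close>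
  define w where "w = scale (of_int x) t - scale (of_int y) s"
  have w1: "w \<in> \<Lambda>\<^sub>1" unfolding L1 w_def
    by (rule CollectI, rule exI[of _ "- y"], rule exI[of _ x]) simp
  have Bvw: "B v w = \<delta>"
  proof -
    have "B v w = of_int (x * a + y * b) * \<delta>" by (simp add: ab w_def ts \<delta>_def[symmetric] algebra_simps)
    then show ?thesis using xy by simp
  qed
  \<comment> \<open>The orthogonal component of \<open>z\<close> contributes nothing, so only a
    determinant of coordinates times \<open>\<delta>\<close> remains.\<close>
  have mult: "\<exists>k::int. B u z = of_int k * \<delta>" if u: "u \<in> \<Lambda>\<^sub>1" and z: "z \<in> \<Lambda>" for u z
  proof -
    obtain u' w' where z': "z = u' + w'" "u' \<in> \<Lambda>\<^sub>1" "w' \<in> perp \<Lambda>\<^sub>1" using z dec by blast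
    obtain a b where 1: "u = scale (of_int a) s + scale (of_int b) t" using u L1 by auto
    obtain p q where 2: "u' = scale (of_int p) s + scale (of_int q) t" using z' L1 by auto
    have "B u z = B u u'" using z' u by (simp add: perp_iff)
    also have "\<dots> = of_int (a * q - b * p) * \<delta>"
      unfolding 1 2 by (simp add: ts \<delta>_def[symmetric] algebra_simps)
    finally show ?thesis by blast
  qed
  have "\<delta> \<in> \<int>" using Bvw integral v(1) w1 sub by (metis subsetD)
  then obtain m where m: "\<delta> = of_int m" by (elim Ints_cases)
  have wL: "w \<in> \<Lambda>" using w1 sub by auto
  obtain z where z: "z \<in> \<Lambda>" "B v z \<noteq> 0" using nondegenerate v by blast
  then have \<delta>0: "\<delta> \<noteq> 0" using mult[OF vin z(1)] by auto
  have "B v ` \<Lambda> = range (\<lambda>k::int. of_nat (nat \<bar>m\<bar>) * of_int k)"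
  proof (intro equalityI subsetI)
    fix r assume "r \<in> B v ` \<Lambda>"
    then obtain k :: int where "r = of_int k * \<delta>" using mult[OF vin] by auto
    then have "r = of_nat (nat \<bar>m\<bar>) * of_int (sgn m * k)"
      unfolding m by (cases m rule: linorder_cases[of _ 0]) (auto simp: abs_if)
    then show "r \<in> range (\<lambda>k::int. of_nat (nat \<bar>m\<bar>) * of_int k)" by blast
  next
    fix r assume "r \<in> range (\<lambda>k::int. (of_nat (nat \<bar>m\<bar>)::rat) * of_int k)"
    then obtain k :: int where "r = of_nat (nat \<bar>m\<bar>) * of_int k" by blast
    then have "r = B v (scale (of_int (sgn m * k)) w)"
      by (cases m rule: linorder_cases[of _ 0]) (auto simp: Bvw m abs_if)
    then show "r \<in> B v ` \<Lambda>" using wL by (blast intro: lattice_scale Ints_of_int)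
  qed
  then have div: "divisibility v = nat \<bar>m\<bar>" using \<delta>0 m by (intro divisibility_eqI) auto
  then have eps: "of_nat (divisibility v) = of_int (sgn m) * \<delta>" "sgn m = 1 \<or> sgn m = -1"
    using \<delta>0 by (auto simp: m abs_if sgn_if)
  have ints: "B w x / \<delta> \<in> \<int>" if "x \<in> \<Lambda>" for x using mult[OF w1 that] \<delta>0 by auto
  show ?thesis
  \<comment> \<open>The divisibility is positive while \<open>\<delta>\<close> may be negative; the
    sign of \<open>m\<close> corrects this.\<close>
  proof (intro bexI[of _ "scale (of_int (sgn m)) w"] conjI ballI)
    show "B v (scale (of_int (sgn m)) w) = of_nat (divisibility v)" using eps Bvw by simp
    show "B (scale (of_int (sgn m)) w) x / of_nat (divisibility v) \<in> \<int>" if "x \<in> \<Lambda>" for x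
      using ints[OF that] eps(2) \<delta>0 unfolding eps(1) by auto
  qed (use wL in auto)
qed

text \<open>The plane spanned by \<open>v\<close> and \<open>w\<close> has the Gram matrix of
  \<open>U\<close> scaled by the divisibility. Since \<open>v\<close> and \<open>w\<close> pair with
  all of \<open>\<Lambda>\<close> in multiples of it, orthogonal projection onto the plane has
  integral coefficients.\<close>

lemma splitting_vectorI:
  assumes prim: "primitive v" and w: "w \<in> \<Lambda>" "B v w = of_nat (divisibility v)"
    "\<And>x. x \<in> \<Lambda> \<Longrightarrow> B w x / of_nat (divisibility v) \<in> \<int>"
  shows "splitting_vector v"
proof -
  note v = primitive_nonzero[OF prim]
  define d :: rat where "d = of_nat (divisibility v)"
  have d: "d \<noteq> 0" using divisibility(1)[OF v] by (simp add: d_def)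
  have Bvw: "B v w = d" "B w v = - d" using w B_skew[of w v] by (auto simp: d_def)
  have vints: "B v x / d \<in> \<int>" if "x \<in> \<Lambda>" for x
    using star_dual[OF v] that by (simp add: dual_iff star_def d_def)
  define L where "L = Z.span {v, w}"
  have L: "L = {scale (of_int a) v + scale (of_int b) w | a b. True}" by (simp add: L_def span_pair)
  have vw: "v \<in> L" "w \<in> L" by (auto simp: L_def Z.span_base)
  have "L \<subseteq> \<Lambda>" unfolding L_def using v w subspace_lattice by (intro Z.span_minimal) auto
  have "v \<noteq> w" using Bvw d by auto
  have indep: "Z.independent {v, w}"
  proof
    assume "Z.dependent {v, w}"
    then obtain p where p: "\<exists>u\<in>{v, w}. p u \<noteq> 0"
      "(\<Sum>u\<in>{v, w}. scale (of_int (p u)) u) = 0"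
      by (auto simp: Z.dependent_finite)
    then have "scale (of_int (p v)) v + scale (of_int (p w)) w = 0" using \<open>v \<noteq> w\<close> by simp
    then have "B v (scale (of_int (p v)) v + scale (of_int (p w)) w) = 0"
      "B w (scale (of_int (p v)) v + scale (of_int (p w)) w) = 0" by (simp_all only: B_zero_right)
    then show False using p(1) d by (auto simp: Bvw)
  qed
  have "free_of_rank L 2"
    unfolding free_of_rank_def using \<open>v \<noteq> w\<close> indep by (intro exI[of _ "{v, w}"]) (auto simp: L_def)
  moreover have "\<Lambda> = {u + z | u z. u \<in> L \<and> z \<in> perp L}"
  proof (intro equalityI subsetI)
    fix x assume x: "x \<in> \<Lambda>"
    \<comment> \<open>This is the orthogonal projection of \<open>x\<close> onto the plane.\<close>
    define u where "u = scale (- B w x / d) v + scale (B v x / d) w"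
    have "- B w x / d \<in> \<int>" "B v x / d \<in> \<int>" using w(3)[OF x] vints[OF x] by (auto simp: d_def)
    then obtain a b where "- B w x / d = of_int a" "B v x / d = of_int b" by (meson Ints_cases)
    then have "u \<in> L" unfolding L u_def by (auto simp del: minus_divide_left)
    have "B v (x - u) = 0" "B w (x - u) = 0" using d by (auto simp: u_def Bvw)
    then have "x - u \<in> perp L" using x \<open>u \<in> L\<close> \<open>L \<subseteq> \<Lambda>\<close> by (auto simp: perp_iff L simp del: B_diff_right)
    then show "x \<in> {u + z | u z. u \<in> L \<and> z \<in> perp L}" using \<open>u \<in> L\<close> by force
  qed (use \<open>L \<subseteq> \<Lambda>\<close> in \<open>auto simp: perp_iff\<close>)
  moreover have "L \<inter> perp L = {0}"
  proof -
    have "x = 0" if x_in: "x \<in> L" "x \<in> perp L" for x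
    proof -
      obtain a b where x: "x = scale (of_int a) v + scale (of_int b) w" using x_in L by auto
      have "B v x = 0" "B w x = 0" using x_in vw by (auto simp: perp_iff)
      then show ?thesis using d by (simp add: x Bvw)
    qed
    moreover have "0 \<in> L" unfolding L_def by (rule Z.span_zero)
    ultimately show ?thesis by (auto simp: perp_iff)
  qed
  ultimately show ?thesis unfolding splitting_vector_def using prim vw \<open>L \<subseteq> \<Lambda>\<close> by blast
qed

theorem splitting_vector_iff:
  assumes prim: "primitive v"
  shows "splitting_vector v \<longleftrightarrow> splitting_element (disc_class (star v))"
proof
  note v = primitive_nonzero[OF prim]
  define d where "d = divisibility v"
  have d: "d > 0" using divisibility(1)[OF v] by (simp add: d_def)
  have ordv: "group.ord disc_group (disc_class (star v)) = d" using ord_star[OF prim] by (simp add: d_def)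
  have sd: "star v \<in> dual" using star_dual v by blast
  have vs: "scale (of_nat d) (star v) = v" using scale_divisibility_star v d_def by simp
  {
    assume "splitting_vector v"
    then obtain w where w: "w \<in> \<Lambda>" "B v w = of_nat d" "\<And>x. x \<in> \<Lambda> \<Longrightarrow> B w x / of_nat d \<in> \<int>"
      using splitting_vector_partner d_def by metis
    define y where "y = scale (1 / of_nat d) w"
    have y: "y \<in> dual" using w by (auto simp: dual_iff y_def)
    have By: "B (star v) y = 1 / of_nat d" using w d by (simp add: y_def star_def d_def[symmetric])
    let ?n = "group.ord disc_group (disc_class y)"
    \<comment> \<open>Since \<open>star v\<close> is dual, a multiple \<open>n\<close> of
      \<open>y\<close> in \<open>\<Lambda>\<close> makes \<open>n / d\<close> integral, so the order
      of the class is no smaller than \<open>d\<close>.\<close>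
    have "scale (of_nat ?n) y \<in> \<Lambda>" using ord_disc_class_dvd[OF y, of ?n] by simp
    then have "B (star v) (scale (of_nat ?n) y) \<in> \<int>" using sd by (auto simp: dual_iff)
    then have "(of_nat ?n :: rat) / of_nat d \<in> \<int>" by (simp add: By)
    then have "d dvd ?n" using d by (simp add: of_nat_divide_in_Ints_iff)
    moreover have "?n dvd d" using ord_disc_class_dvd[OF y, of d] w(1) d by (simp add: y_def)
    ultimately have "?n = d" by (simp add: dvd_antisym)
    then show "splitting_element (disc_class (star v))"
      unfolding splitting_element_def ordv using sd y By
      by (auto simp: carrier_disc disc_form_class intro!: bexI[of _ "disc_class y"])
  }
  {
    assume "splitting_element (disc_class (star v))"
    then obtain y where y: "y \<in> dual" "group.ord disc_group (disc_class y) = d"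
      "disc_form (disc_class (star v)) (disc_class y) = rat_class (1 / of_nat d)"
      unfolding splitting_element_def ordv carrier_disc by blast
    have "B (star v) y - 1 / of_nat d \<in> \<int>"
      using y sd by (simp add: disc_form_class rat_class_eq_iff)
    moreover obtain u where u: "u \<in> \<Lambda>" "B (star v) u = 1" using star_unimodular v by blast
    ultimately obtain k :: int where k: "B (star v) y = 1 / of_nat d + of_int k"
      by (auto elim!: Ints_cases simp: algebra_simps)
    \<comment> \<open>The pairing with \<open>y\<close> is known only modulo integers; a multiple of
      \<open>u\<close>, on which \<open>star v\<close> is 1, makes it exactly \<open>1 / d\<close>
      within the same class.\<close>
    define y' where "y' = y - scale (of_int k) u"
    have ku: "scale (of_int k) u \<in> \<Lambda>" using u(1) by (intro lattice_scale Ints_of_int)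
    have y'y: "y' - y \<in> \<Lambda>" using lattice_minus[OF ku] by (simp add: y'_def)
    have y': "y' \<in> dual" using y(1) y'y by (rule dual_congruent)
    have By': "B (star v) y' = 1 / of_nat d" by (simp add: y'_def k u)
    have "disc_class y' = disc_class y" using disc_class_eq_iff y'y by metis
    then have "scale (of_nat d) y' \<in> \<Lambda>" using ord_disc_class_dvd[OF y', of d] y(2) by simp
    moreover have "B v (scale (of_nat d) y') = of_nat d"
      using By' d by (subst vs[symmetric]) simp
    moreover have "B (scale (of_nat d) y') x / of_nat d \<in> \<int>" if "x \<in> \<Lambda>" for x
      using y' that d by (simp add: dual_iff)
    ultimately show "splitting_vector v" using prim unfolding d_def by (intro splitting_vectorI)
  }
qed

subsection \<open>Isometries acting trivially on the discriminant group\<close>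

lemma rational_extension_eqI:
  assumes h: "Vector_Spaces.linear scale scale h" "\<And>x. x \<in> \<Lambda> \<Longrightarrow> h x = \<gamma> x"
  shows "rational_extension \<gamma> = h"
  unfolding rational_extension_def
proof (rule the_equality)
  fix h' assume h': "Vector_Spaces.linear scale scale h' \<and> (\<forall>x\<in>\<Lambda>. h' x = \<gamma> x)"
  show "h' = h"
  proof
    fix x
    obtain N :: nat where N: "N > 0" "scale (of_nat N) x \<in> \<Lambda>" using multiple_in_lattice by blast
    then have "h' (scale (of_nat N) x) = h (scale (of_nat N) x)" using h h' by simp
    then have "scale (of_nat N) (h' x) = scale (of_nat N) (h x)"
      using h(1) h' by (simp add: linear_iff_additive_homogeneous)
    then show "h' x = h x" using N(1) by simp
  qed
qed (use h in auto)

text \<open>The extension sends \<open>x\<close> to \<open>\<gamma>\<close> of \<open>N x\<close>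
  divided by \<open>N\<close>. The fact \<open>h\<close> makes this independent of the chosen
  \<open>N\<close>, so a common denominator can be used for sums.\<close>

lemma rational_extension:
  assumes add: "\<And>x y. x \<in> \<Lambda> \<Longrightarrow> y \<in> \<Lambda> \<Longrightarrow> \<gamma> (x + y) = \<gamma> x + \<gamma> y"
  shows "Vector_Spaces.linear scale scale (rational_extension \<gamma>)"
    and "x \<in> \<Lambda> \<Longrightarrow> rational_extension \<gamma> x = \<gamma> x"
proof -
  have zero: "\<gamma> 0 = 0" using add[of 0 0] by simp
  have nat: "\<gamma> (scale (of_nat n) x) = scale (of_nat n) (\<gamma> x)" if "x \<in> \<Lambda>" for n x
    by (induction n) (use that in \<open>auto simp: zero add scale_left_distrib lattice_scale\<close>)
  define h where "h = (\<lambda>x. let N = SOME N::nat. N > 0 \<and> scale (of_nat N) x \<in> \<Lambda>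
      in scale (1 / of_nat N) (\<gamma> (scale (of_nat N) x)))"
  have h: "h x = scale (1 / of_nat M) (\<gamma> (scale (of_nat M) x))"
    if M: "M > 0" "scale (of_nat M) x \<in> \<Lambda>" for M :: nat and x
  proof -
    define N where "N = (SOME N::nat. N > 0 \<and> scale (of_nat N) x \<in> \<Lambda>)"
    have N: "N > 0" "scale (of_nat N) x \<in> \<Lambda>"
      using someI_ex[OF multiple_in_lattice[of x]] unfolding N_def by auto
    have "scale (of_nat M) (\<gamma> (scale (of_nat N) x)) = scale (of_nat N) (\<gamma> (scale (of_nat M) x))"
      unfolding nat[OF N(2), symmetric] nat[OF M(2), symmetric] by (simp add: mult.commute)
    then have "scale (1 / (of_nat M * of_nat N)) (scale (of_nat M) (\<gamma> (scale (of_nat N) x)))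
        = scale (1 / (of_nat M * of_nat N)) (scale (of_nat N) (\<gamma> (scale (of_nat M) x)))"
      by (rule arg_cong)
    then show ?thesis using M(1) N(1) by (simp add: h_def N_def[symmetric])
  qed
  have h_add: "h (x + y) = h x + h y" for x y
  proof -
    obtain N :: nat where N: "N > 0" "scale (of_nat N) x \<in> \<Lambda>" using multiple_in_lattice by blast
    obtain M :: nat where M: "M > 0" "scale (of_nat M) y \<in> \<Lambda>" using multiple_in_lattice by blast
    have x: "scale (of_nat (N * M)) x \<in> \<Lambda>"
      using lattice_scale[OF _ N(2), of "of_nat M"] by (simp add: mult.commute)
    have y: "scale (of_nat (N * M)) y \<in> \<Lambda>"
      using lattice_scale[OF _ M(2), of "of_nat N"] by simp
    have xy: "scale (of_nat (N * M)) (x + y) \<in> \<Lambda>"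
      using lattice_add[OF x y] by (simp add: scale_right_distrib)
    have NM: "N * M > 0" using N M by simp
    show ?thesis unfolding h[OF NM x] h[OF NM y] h[OF NM xy]
      using add[OF x y] by (simp add: scale_right_distrib)
  qed
  have lin: "Vector_Spaces.linear scale scale h" using h_add by (rule additive_imp_linear)
  have hx: "h x = \<gamma> x" if "x \<in> \<Lambda>" for x using h[of 1 x] that by simp
  have "rational_extension \<gamma> = h" using lin hx by (rule rational_extension_eqI)
  then show "Vector_Spaces.linear scale scale (rational_extension \<gamma>)"
    and "x \<in> \<Lambda> \<Longrightarrow> rational_extension \<gamma> x = \<gamma> x"
    using lin hx by auto
qed

text \<open>Elements of \<open>Gamma_group\<close> are restricted to \<open>\<Lambda>\<close>. Their
  linear extensions act on \<open>star v\<close> directly, and \<open>carrier_Gamma\<close>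
  identifies the two descriptions.\<close>

definition discriminant_isometry :: "('v \<Rightarrow> 'v) \<Rightarrow> bool" where
  "discriminant_isometry h \<longleftrightarrow> Vector_Spaces.linear scale scale h \<and> bij_betw h \<Lambda> \<Lambda> \<and>
     (\<forall>x y. B (h x) (h y) = B x y) \<and> (\<forall>x\<in>dual. h x - x \<in> \<Lambda>)"

lemma carrier_Gamma_iff:
  "\<gamma> \<in> carrier Gamma_group \<longleftrightarrow>
     \<gamma> \<in> extensional \<Lambda> \<and> bij_betw \<gamma> \<Lambda> \<Lambda> \<and> (\<forall>x\<in>\<Lambda>. \<forall>y\<in>\<Lambda>. \<gamma> (x + y) = \<gamma> x + \<gamma> y) \<and>
     (\<forall>x\<in>\<Lambda>. \<forall>y\<in>\<Lambda>. B (\<gamma> x) (\<gamma> y) = B x y) \<and>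
     (\<forall>X\<in>carrier disc_group. rational_extension \<gamma> ` X = X)"
proof -
  \<comment> \<open>The unit of \<open>Sp_disc\<close> is the identity restricted to the carrier,
    and \<open>induced\<close> is restricted likewise, so equality is tested only there.\<close>
  have "induced \<gamma> = \<one>\<^bsub>Sp_disc\<^esub> \<longleftrightarrow> (\<forall>X\<in>carrier disc_group. rational_extension \<gamma> ` X = X)"
    by (auto simp: induced_def Sp_disc_def isometry_group_def AutoGroup_def BijGroup_def
        restrict_def fun_eq_iff)
  then show ?thesis
    by (auto simp: Gamma_group_def kernel_def Sp_lattice_def isometry_group_def auto_def Bij_def
        hom_def add_group_on_def bij_betw_def)
qed

lemma discriminant_isometry_image_disc_class:
  assumes h: "discriminant_isometry h" and x: "x \<in> dual"
  shows "h ` disc_class x = disc_class x"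
proof (intro equalityI subsetI)
  have lin: "h (a + b) = h a + h b" for a b using h by (simp add: discriminant_isometry_def linear_iff_additive_homogeneous)
  have hL: "h l \<in> \<Lambda>" if "l \<in> \<Lambda>" for l using h that by (auto simp: discriminant_isometry_def bij_betw_def)
  have hx: "h x - x \<in> \<Lambda>" using h x by (simp add: discriminant_isometry_def)
  {
    fix y assume "y \<in> h ` disc_class x"
    then obtain z where z: "y = h z" "z - x \<in> \<Lambda>" by (auto simp: in_disc_class_iff)
    have "y - x = h (z - x) + (h x - x)" using lin[of "z - x" x] z by simp
    then show "y \<in> disc_class x" using hL[OF z(2)] hx by (metis in_disc_class_iff lattice_add)
  }
  {
    fix y assume "y \<in> disc_class x"
    \<comment> \<open>The error \<open>y - h x\<close> is a lattice vector, and \<open>h\<close>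
      maps \<open>\<Lambda>\<close> onto itself, so it can be absorbed into the preimage.\<close>
    then have "(y - x) - (h x - x) \<in> \<Lambda>" using hx in_disc_class_iff by blast
    then have "y - h x \<in> h ` \<Lambda>" using h by (simp add: discriminant_isometry_def bij_betw_def)
    then obtain l where l: "l \<in> \<Lambda>" "h l = y - h x" by auto
    then have "y = h (l + x)" by (simp add: lin)
    then show "y \<in> h ` disc_class x" using l by (auto simp: in_disc_class_iff)
  }
qed

lemma carrier_Gamma:
  "carrier Gamma_group = (\<lambda>h. restrict h \<Lambda>) ` Collect discriminant_isometry"
proof (intro equalityI subsetI)
  fix \<gamma> assume "\<gamma> \<in> carrier Gamma_group"
  then have \<gamma>: "\<gamma> \<in> extensional \<Lambda>" "bij_betw \<gamma> \<Lambda> \<Lambda>" "\<And>x y. x \<in> \<Lambda> \<Longrightarrow> y \<in> \<Lambda> \<Longrightarrow> \<gamma> (x + y) = \<gamma> x + \<gamma> y"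
    "\<And>x y. x \<in> \<Lambda> \<Longrightarrow> y \<in> \<Lambda> \<Longrightarrow> B (\<gamma> x) (\<gamma> y) = B x y"
    "\<And>X. X \<in> carrier disc_group \<Longrightarrow> rational_extension \<gamma> ` X = X"
    by (auto simp: carrier_Gamma_iff)
  define h where "h = rational_extension \<gamma>"
  have lin: "Vector_Spaces.linear scale scale h" and h: "\<And>x. x \<in> \<Lambda> \<Longrightarrow> h x = \<gamma> x"
    using rational_extension[OF \<gamma>(3)] by (auto simp: h_def)
  have hs: "h (scale c x) = scale c (h x)" for c x using lin by (simp add: linear_iff_additive_homogeneous)
  have "bij_betw h \<Lambda> \<Lambda>" using \<gamma>(2) by (simp add: h cong: bij_betw_cong)
  moreover have "B (h x) (h y) = B x y" for x y
  proof -
    obtain N :: nat where N: "N > 0" "scale (of_nat N) x \<in> \<Lambda>" using multiple_in_lattice by blast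
    obtain M :: nat where M: "M > 0" "scale (of_nat M) y \<in> \<Lambda>" using multiple_in_lattice by blast
    have "B (h (scale (of_nat N) x)) (h (scale (of_nat M) y)) = B (scale (of_nat N) x) (scale (of_nat M) y)"
      using h N M \<gamma>(4) by simp
    then show ?thesis using N(1) M(1) by (simp add: hs)
  qed
  moreover have "h x - x \<in> \<Lambda>" if x: "x \<in> dual" for x
  proof -
    have "x \<in> disc_class x" by (simp add: in_disc_class_iff)
    then have "h x \<in> disc_class x" using \<gamma>(5)[of "disc_class x"] x by (auto simp: carrier_disc h_def)
    then show ?thesis by (simp add: in_disc_class_iff)
  qed
  ultimately have "discriminant_isometry h" using lin by (simp add: discriminant_isometry_def)
  moreover have "\<gamma> = restrict h \<Lambda>" using \<gamma>(1) h by (intro extensionalityI[of _ \<Lambda>]) auto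
  ultimately show "\<gamma> \<in> (\<lambda>h. restrict h \<Lambda>) ` Collect discriminant_isometry" by blast
next
  fix \<gamma> assume "\<gamma> \<in> (\<lambda>h. restrict h \<Lambda>) ` Collect discriminant_isometry"
  then obtain h where \<gamma>: "\<gamma> = restrict h \<Lambda>" and h: "discriminant_isometry h" by blast
  have lin: "Vector_Spaces.linear scale scale h" using h by (simp add: discriminant_isometry_def)
  have "rational_extension \<gamma> = h" using lin by (rule rational_extension_eqI) (simp add: \<gamma>)
  then have "rational_extension \<gamma> ` X = X" if "X \<in> carrier disc_group" for X
    using that discriminant_isometry_image_disc_class[OF h] by (auto simp: carrier_disc)
  moreover have "bij_betw \<gamma> \<Lambda> \<Lambda>"
    using h unfolding \<gamma> discriminant_isometry_def by simp
  ultimately show "\<gamma> \<in> carrier Gamma_group"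
    using h lin by (auto simp: carrier_Gamma_iff discriminant_isometry_def linear_iff_additive_homogeneous \<gamma>)
qed

lemma discriminant_isometry_id: "discriminant_isometry (\<lambda>x. x)"
  by (auto simp: discriminant_isometry_def linear_iff_additive_homogeneous vector_space_axioms bij_betw_def)

lemma discriminant_isometry_compose:
  assumes "discriminant_isometry h" "discriminant_isometry k"
  shows "discriminant_isometry (h \<circ> k)"
proof -
  have "h (k x) - x \<in> \<Lambda>" if x: "x \<in> dual" for x
  proof -
    have kx: "k x - x \<in> \<Lambda>" using assms x by (simp add: discriminant_isometry_def)
    then have "h (k x) - k x \<in> \<Lambda>"
      using assms dual_congruent[OF x kx] by (simp add: discriminant_isometry_def)
    then show ?thesis using lattice_add[OF _ kx] by fastforce
  qed
  then show ?thesis using assms bij_betw_trans[of k \<Lambda> \<Lambda> h \<Lambda>]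
    by (auto simp: discriminant_isometry_def linear_iff_additive_homogeneous)
qed

text \<open>Because \<open>B a a = 0\<close>, the inverse is the same map with \<open>-c\<close>. A
  dual vector pairs integrally with \<open>a\<close>, so it moves by a lattice vector.\<close>

lemma transvection:
  assumes a: "a \<in> \<Lambda>" and c: "c \<in> \<int>"
  shows "discriminant_isometry (\<lambda>x. x + scale (c * B x a) a)" (is "discriminant_isometry ?t")
  unfolding discriminant_isometry_def
proof (intro conjI allI ballI)
  have maps: "x + scale (c * B x a) a \<in> \<Lambda>" if "x \<in> \<Lambda>" "c \<in> \<int>" for x c
    using that a by (intro lattice_add lattice_scale Ints_mult integral)
  show "bij_betw ?t \<Lambda> \<Lambda>"
  proof (rule bij_betw_byWitness[where f' = "\<lambda>x. x + scale (- c * B x a) a"])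
    show "?t ` \<Lambda> \<subseteq> \<Lambda>" using maps[OF _ c] by (rule image_subsetI)
    show "(\<lambda>x. x + scale (- c * B x a) a) ` \<Lambda> \<subseteq> \<Lambda>"
      using maps[of _ "- c"] c by (intro image_subsetI) simp
  qed simp_all
  show "B (?t x) (?t y) = B x y" for x y
    using B_skew[of a y] by simp
  show "?t x - x \<in> \<Lambda>" if "x \<in> dual" for x
  proof -
    have "c * B x a \<in> \<int>" using that a c by (intro Ints_mult) (auto simp: dual_iff)
    then show ?thesis using a by (simp add: lattice_scale)
  qed
  show "Vector_Spaces.linear scale scale ?t"
    by (rule additive_imp_linear) (simp add: algebra_simps)
qed

section \<open>Chains of transvections\<close>

inductive linked :: "'v \<Rightarrow> 'v \<Rightarrow> bool" where
  linkedI: "z' - z \<in> \<Lambda> \<Longrightarrow> B z z' = 1 \<or> B z z' = -1 \<Longrightarrow> linked z z'"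

lemma linked_sym: "linked z z' \<Longrightarrow> linked z' z"
  using lattice_minus[of "z' - z"] B_skew[of z z'] by (auto simp: linked.simps)

lemma linked_path_sym: "linked\<^sup>*\<^sup>* z z' \<Longrightarrow> linked\<^sup>*\<^sup>* z' z"
  by (induction rule: rtranclp_induct) (auto intro: converse_rtranclp_into_rtranclp linked_sym)

lemma linked_path_isometry: "linked\<^sup>*\<^sup>* z z' \<Longrightarrow> \<exists>h. discriminant_isometry h \<and> h z = z'"
proof (induction rule: rtranclp_induct)
  case base
  show ?case using discriminant_isometry_id by blast
next
  case (step y z')
  then obtain h where h: "discriminant_isometry h" "h z = y" by blast
  have d: "z' - y \<in> \<Lambda>" "B y z' = 1 \<or> B y z' = -1" using step(2) by (auto simp: linked.simps)
  \<comment> \<open>The pairings of \<open>y\<close> with \<open>z' - y\<close> and with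
    \<open>z'\<close> agree, so the coefficient at \<open>y\<close> is the square of a sign and
    \<open>y\<close> moves by exactly \<open>z' - y\<close>.\<close>
  then have "B y z' \<in> \<int>" "B y z' * B y z' = 1" by auto
  moreover have "B y (z' - y) = B y z'" by simp
  ultimately have "discriminant_isometry (\<lambda>x. x + scale (B y z' * B x (z' - y)) (z' - y))"
    "y + scale (B y z' * B y (z' - y)) (z' - y) = z'"
    using transvection[OF d(1), of "B y z'"] by auto
  then show ?case using discriminant_isometry_compose[OF _ h(1)] h(2) by (metis comp_apply)
qed

section \<open>Congruent vectors in the presence of two orthogonal unimodular planes\<close>

context
  fixes e1 f1 e2 f2 :: 'v
  assumes in_lattice: "e1 \<in> \<Lambda>" "f1 \<in> \<Lambda>" "e2 \<in> \<Lambda>" "f2 \<in> \<Lambda>"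
    and gram: "B e1 f1 = 1" "B e2 f2 = 1" "B e1 e2 = 0" "B e1 f2 = 0" "B f1 e2 = 0" "B f1 f2 = 0"
begin

lemma gram_skew: "B f1 e1 = -1" "B f2 e2 = -1" "B e2 e1 = 0" "B f2 e1 = 0" "B e2 f1 = 0" "B f2 f1 = 0"
  using gram B_skew by (metis minus_zero)+

text \<open>Both argument orders are recorded so that simplification evaluates pairings without
  appeal to skew-symmetry.\<close>

definition planes_perp :: "'v \<Rightarrow> bool" where
  "planes_perp k \<longleftrightarrow> B e1 k = 0 \<and> B f1 k = 0 \<and> B e2 k = 0 \<and> B f2 k = 0 \<and>
     B k e1 = 0 \<and> B k f1 = 0 \<and> B k e2 = 0 \<and> B k f2 = 0"

text \<open>A direct step would have pairing \<open>B k k'\<close>, which need not be a sign. The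
  chain exchanges \<open>k\<close> for \<open>k'\<close> at a vector involving the second plane and
  then returns to \<open>e1\<close>.\<close>

lemma linked_path_change_perp:
  assumes k: "planes_perp k" "k \<in> dual" "planes_perp k'" "k' - k \<in> \<Lambda>"
  shows "linked\<^sup>*\<^sup>* (e1 + k) (e1 + k')"
proof -
  note simps = planes_perp_def gram gram_skew
  \<comment> \<open>With this choice \<open>c + B k k' = 1\<close> is the pairing of the first
    step.\<close>
  define c where "c = 1 - B k k'"
  have "B k k' = B k (k' - k)" by simp
  also have "\<dots> \<in> \<int>" using k unfolding dual_iff by blast
  finally have c: "c \<in> \<int>" by (simp add: c_def)
  have 1: "linked (e1 + k) (scale c f1 + e2 + k')"
  proof (rule linkedI)
    have eq: "scale c f1 + e2 + k' - (e1 + k) = scale c f1 + e2 - e1 + (k' - k)" by simp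
    show "scale c f1 + e2 + k' - (e1 + k) \<in> \<Lambda>" unfolding eq
      using in_lattice c k(4) by (intro lattice_add[OF _ k(4)] lattice_diff lattice_add lattice_scale)
  qed (use k in \<open>simp add: simps c_def\<close>)
  \<comment> \<open>From here on both ends carry \<open>k'\<close>, which drops out of the pairings:
    they are 1, -1 and -1, computed in the planes.\<close>
  have 2: "linked (scale c f1 + e2 + k') (f2 + k')"
  proof (rule linkedI)
    have eq: "f2 + k' - (scale c f1 + e2 + k') = f2 - e2 - scale c f1" by simp
    show "f2 + k' - (scale c f1 + e2 + k') \<in> \<Lambda>" unfolding eq using in_lattice c by blast
  qed (use k in \<open>simp add: simps\<close>)
  have 3: "linked (f2 + k') (e2 + f1 + k')"
  proof (rule linkedI)
    have eq: "e2 + f1 + k' - (f2 + k') = e2 + f1 - f2" by simp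
    show "e2 + f1 + k' - (f2 + k') \<in> \<Lambda>" unfolding eq using in_lattice by blast
  qed (use k in \<open>simp add: simps\<close>)
  have 4: "linked (e2 + f1 + k') (e1 + k')"
  proof (rule linkedI)
    have eq: "e1 + k' - (e2 + f1 + k') = e1 - (e2 + f1)" by simp
    show "e1 + k' - (e2 + f1 + k') \<in> \<Lambda>" unfolding eq using in_lattice by blast
  qed (use k in \<open>simp add: simps\<close>)
  show ?thesis by (rule 1 2 3 4 rtranclp.rtrancl_refl converse_rtranclp_into_rtranclp)+
qed

text \<open>
  The vector \<open>p\<close> in the second plane is chosen with \<open>B z p = 0\<close>, so adding a multiple of it to \<open>\<mu>\<close>
  keeps \<open>B z \<mu> = 1\<close> and prescribes the pairing of the next vector with \<open>q\<close>.
\<close>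

lemma linked_path_normal_form:
  assumes z: "z \<in> dual" and unimodular: "\<mu> \<in> \<Lambda>" "B z \<mu> = 1"
  obtains k where "planes_perp k" "k - z \<in> \<Lambda>" "linked\<^sup>*\<^sup>* z (e1 + k)"
proof -
  note simps = planes_perp_def gram gram_skew
  have ints: "B x y \<in> \<int>" if "x \<in> dual" "y \<in> \<Lambda>" for x y using that by (auto simp: dual_iff)
  obtain \<gamma> :: int where \<gamma>: "B z f2 = of_int \<gamma>" using ints[OF z in_lattice(4)] by (elim Ints_cases)
  obtain \<delta> :: int where \<delta>: "B z e2 = of_int \<delta>" using ints[OF z in_lattice(3)] by (elim Ints_cases)
  \<comment> \<open>The first equation makes \<open>p\<close> orthogonal to \<open>z\<close>; the
    second makes \<open>q\<close> a partner of \<open>p\<close>.\<close>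
  obtain \<gamma>' \<delta>' u v where uv: "\<gamma> * \<delta>' = (-\<delta>) * \<gamma>'" "u * \<gamma>' + v * \<delta>' = 1" by (rule int_bezout_pair)
  define p where "p = scale (of_int \<gamma>') e2 + scale (of_int \<delta>') f2"
  define q where "q = scale (of_int u) f2 - scale (of_int v) e2"
  have pq: "p \<in> \<Lambda>" "q \<in> \<Lambda>" unfolding p_def q_def using in_lattice by blast+
  have "B p q = of_int (u * \<gamma>' + v * \<delta>')" by (simp add: p_def q_def gram gram_skew algebra_simps)
  then have Bpq: "B p q = 1" by (simp add: uv)
  have "B z p = of_int (\<gamma> * \<delta>' - (-\<delta>) * \<gamma>')" by (simp add: p_def \<gamma> \<delta> algebra_simps)
  then have Bzp: "B z p = 0" by (simp add: uv)
  have Bq: "B q e1 = 0" "B q f1 = 0" "B e1 q = 0" "B f1 q = 0" by (simp_all add: q_def gram gram_skew)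
  \<comment> \<open>Since \<open>B p q = 1\<close>, this gives \<open>B z1 q = 1\<close>, while
    \<open>B z z1\<close> stays 1 because \<open>p\<close> is orthogonal to
    \<open>z\<close>.\<close>
  define t where "t = 1 - B z q - B \<mu> q"
  have t: "t \<in> \<int>" using ints[OF z pq(2)] integral[OF unimodular(1) pq(2)] by (auto simp: t_def)
  define z1 where "z1 = z + \<mu> + scale t p"
  have "z1 - z = \<mu> + scale t p" by (simp add: z1_def)
  then have z1: "z1 - z \<in> \<Lambda>" using unimodular pq t by auto
  have d1: "z1 \<in> dual" using z z1 by (rule dual_congruent)
  have 1: "linked z z1" using z1 by (rule linkedI) (simp add: z1_def unimodular Bzp)
  have Bz1q: "B z1 q = 1" by (simp add: z1_def t_def Bpq)
  \<comment> \<open>The coefficient \<open>s\<close> of \<open>e1\<close> achieves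
    \<open>B z2 f1 = 1\<close>. The multiple \<open>c\<close> of \<open>q\<close> restores the
    pairing \<open>B z1 z2 = 1\<close> without affecting this, as \<open>q\<close> is orthogonal to
    \<open>f1\<close>.\<close>
  define s where "s = 1 - B z1 f1"
  define c where "c = 1 - s * B z1 e1"
  have sc: "s \<in> \<int>" "c \<in> \<int>" using ints[OF d1] in_lattice by (auto simp: s_def c_def)
  define z2 where "z2 = z1 + scale s e1 + scale c q"
  have "z2 - z1 = scale s e1 + scale c q" by (simp add: z2_def)
  then have z2: "z2 - z1 \<in> \<Lambda>" using in_lattice pq sc by auto
  have d2: "z2 \<in> dual" using d1 z2 by (rule dual_congruent)
  have 2: "linked z1 z2" using z2 by (rule linkedI) (simp add: z2_def Bz1q c_def)
  have Bz2: "B z2 f1 = 1" by (simp add: z2_def s_def Bq gram)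
  \<comment> \<open>This is the orthogonal projection of \<open>z2\<close> onto the two planes; its
    coefficients are integral because \<open>z2\<close> is dual.\<close>
  define w where "w = scale (B z2 f1) e1 - scale (B z2 e1) f1 + scale (B z2 f2) e2 - scale (B z2 e2) f2"
  define k where "k = z2 - w"
  have "B k e1 = 0" "B k f1 = 0" "B k e2 = 0" "B k f2 = 0"
    by (simp_all add: k_def w_def gram gram_skew)
  then have k: "planes_perp k"
    using B_skew[of e1 k] B_skew[of f1 k] B_skew[of e2 k] B_skew[of f2 k] by (simp add: planes_perp_def)
  have w: "w \<in> \<Lambda>" unfolding w_def by (intro lattice_add lattice_diff lattice_scale ints[OF d2] in_lattice)
  have z3: "f1 + k - z2 \<in> \<Lambda>" using lattice_diff[OF in_lattice(2) w] by (simp add: k_def)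
  \<comment> \<open>As \<open>z2 = w + k\<close> and \<open>B k k = 0\<close>, pairing
    \<open>z2\<close> with \<open>k\<close> amounts to pairing \<open>w\<close> with
    \<open>k\<close>.\<close>
  have "B z2 (f1 + k) = 1 + B w k" by (simp add: Bz2) (simp add: k_def B_skew[of z2 w])
  also have "B w k = 0" using k by (simp add: w_def planes_perp_def)
  finally have 3: "linked z2 (f1 + k)" using z3 by (intro linkedI) auto
  have 4: "linked (f1 + k) (e1 + k)"
    by (rule linkedI) (use k in_lattice in \<open>auto simp: simps\<close>)
  have "linked\<^sup>*\<^sup>* z (e1 + k)" by (rule 1 2 3 4 rtranclp.rtrancl_refl converse_rtranclp_into_rtranclp)+
  moreover have "(z1 - z) + (z2 - z1) - w \<in> \<Lambda>" using z1 z2 w by blast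
  then have "k - z \<in> \<Lambda>" by (simp add: k_def algebra_simps)
  ultimately show ?thesis using k that by blast
qed

text \<open>Both vectors are joined to normal forms \<open>e1 + k\<close> and \<open>e1 + k'\<close>
  with \<open>k' - k\<close> in \<open>\<Lambda>\<close>; these are joined to each other, and the
  second chain is reversed.\<close>

lemma congruent_unimodular_isometric:
  assumes z: "z \<in> dual" "\<exists>y\<in>\<Lambda>. B z y = 1" and z': "z' - z \<in> \<Lambda>" "\<exists>y\<in>\<Lambda>. B z' y = 1"
  shows "\<exists>h. discriminant_isometry h \<and> h z = z'"
proof -
  have z'd: "z' \<in> dual" using z(1) z'(1) by (rule dual_congruent)
  obtain k where k: "planes_perp k" "k - z \<in> \<Lambda>" "linked\<^sup>*\<^sup>* z (e1 + k)"
    using linked_path_normal_form z by metis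
  obtain k' where k': "planes_perp k'" "k' - z' \<in> \<Lambda>" "linked\<^sup>*\<^sup>* z' (e1 + k')"
    using linked_path_normal_form z'd z'(2) by metis
  have "k' - k = (k' - z') + (z' - z) - (k - z)" by simp
  then have "k' - k \<in> \<Lambda>" using k(2) k'(2) z'(1) by (metis lattice_add lattice_diff)
  then have "linked\<^sup>*\<^sup>* (e1 + k) (e1 + k')"
    using linked_path_change_perp k(1) k'(1) dual_congruent[OF z(1) k(2)] by blast
  then have "linked\<^sup>*\<^sup>* z z'" using k(3) linked_path_sym[OF k'(3)] by (metis rtranclp_trans)
  then show ?thesis by (rule linked_path_isometry)
qed

lemma dual_class_primitive:
  assumes x: "x \<in> dual"
  shows "\<exists>v. primitive v \<and> disc_class (star v) = disc_class x"
proof -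
  define z where "z = x + scale (1 - B x f1) e1"
  have "z - x = scale (1 - B x f1) e1" by (simp add: z_def)
  moreover have "B x f1 \<in> \<int>" using x in_lattice(2) unfolding dual_iff by blast
  ultimately have zx: "z - x \<in> \<Lambda>" using in_lattice(1) by (simp add: lattice_scale Ints_diff)
  have z: "z \<in> dual" using x zx by (rule dual_congruent)
  have Bz: "B z f1 = 1" by (simp add: z_def gram)
  \<comment> \<open>The order is the least factor bringing \<open>z\<close> into
    \<open>\<Lambda>\<close>; as \<open>B z f1 = 1\<close>, it is also the divisibility of the
    resulting \<open>v\<close>.\<close>
  define d where "d = group.ord disc_group (disc_class z)"
  have d: "d > 0" using ord_disc_class_pos[OF z] by (simp add: d_def)
  define v where "v = scale (of_nat d) z"
  have v: "v \<in> \<Lambda>" using ord_disc_class_dvd[OF z, of d] by (simp add: d_def v_def)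
  have Bv: "B v f1 = of_nat d" by (simp add: v_def Bz)
  have v0: "v \<noteq> 0" using Bv d by auto
  have "B v ` \<Lambda> = range (\<lambda>k::int. of_nat d * of_int k)"
  proof (intro equalityI subsetI)
    fix r assume "r \<in> B v ` \<Lambda>"
    then obtain y where y: "y \<in> \<Lambda>" "r = of_nat d * B z y" by (auto simp: v_def)
    then have "B z y \<in> \<int>" using z by (auto simp: dual_iff)
    then show "r \<in> range (\<lambda>k::int. of_nat d * of_int k)" using y by (auto elim!: Ints_cases)
  next
    fix r assume "r \<in> range (\<lambda>k::int. (of_nat d :: rat) * of_int k)"
    then obtain k :: int where "r = B v (scale (of_int k) f1)" by (auto simp: Bv mult.commute)
    moreover have "scale (of_int k) f1 \<in> \<Lambda>" using in_lattice(2) by (intro lattice_scale Ints_of_int)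
    ultimately show "r \<in> B v ` \<Lambda>" by (rule image_eqI)
  qed
  then have "divisibility v = d" using d by (intro divisibility_eqI)
  then have star: "star v = z" using d by (simp add: star_def v_def)
  have "primitive v"
  proof (rule primitiveI[OF v v0])
    fix q assume q: "scale q v \<in> \<Lambda>"
    then have "B (scale q v) f1 \<in> \<int>" using in_lattice(2) by (rule integral)
    \<comment> \<open>Thus \<open>scale q v\<close> is an integral multiple \<open>m\<close> of
      \<open>z\<close>. It lies in \<open>\<Lambda>\<close> only if \<open>d\<close> divides
      \<open>m\<close>, that is, if \<open>q\<close> is an integer.\<close>
    then obtain m :: int where m: "q * of_nat d = of_int m" unfolding B_scale_left Bv by (elim Ints_cases)
    have "scale (of_int m) z \<in> \<Lambda>" using q by (simp add: v_def m)
    then have "scale (of_int \<bar>m\<bar>) z \<in> \<Lambda>"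
      using lattice_minus[of "scale (of_int m) z"] by (simp add: abs_if)
    then have "scale (of_nat (nat \<bar>m\<bar>)) z \<in> \<Lambda>" by simp
    then have "d dvd nat \<bar>m\<bar>" unfolding d_def by (rule iffD2[OF ord_disc_class_dvd[OF z]])
    then have "int d dvd int (nat \<bar>m\<bar>)" by (simp only: int_dvd_int_iff)
    then have "int d dvd m" by simp
    then obtain j where "m = int d * j" by blast
    then have "q = of_int j" using m d by simp
    then show "q \<in> \<int>" by simp
  qed
  moreover have "disc_class z = disc_class x" using zx disc_class_eq_iff by metis
  ultimately show ?thesis using star by (intro exI[of _ v]) simp
qed

section \<open>Orbits of splitting vectors\<close>

theorem orbit_splitting_vector:
  assumes v: "splitting_vector v"
  shows "orbit Gamma_group (\<lambda>\<gamma> v. \<gamma> v) v =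
    {u. splitting_vector u \<and> disc_class (star u) = disc_class (star v)}"
proof (intro equalityI subsetI)
  have prim: "primitive v" using v by (simp add: splitting_vector_def)
  note vL = primitive_nonzero[OF prim]
  {
    fix u assume "u \<in> orbit Gamma_group (\<lambda>\<gamma> v. \<gamma> v) v"
    then obtain h where h: "discriminant_isometry h" and u: "u = h v"
      using vL by (auto simp: orbit_def carrier_Gamma)
    have hs: "h (scale c x) = scale c (h x)" for c x
      using h by (simp add: discriminant_isometry_def linear_iff_additive_homogeneous)
    have hB: "B (h x) (h y) = B x y" for x y using h by (simp add: discriminant_isometry_def)
    have inj: "inj_on h \<Lambda>" and hL: "h ` \<Lambda> = \<Lambda>"
      using h by (auto simp: discriminant_isometry_def bij_betw_def)
    have uL: "u \<in> \<Lambda>" using hL vL u by blast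
    obtain y where "y \<in> \<Lambda>" "B v y \<noteq> 0" using nondegenerate vL by blast
    then have u0: "u \<noteq> 0" using hB[of v y] u by auto
    have primu: "primitive u"
    proof (rule primitiveI[OF uL u0])
      fix q assume "scale q u \<in> \<Lambda>"
      then obtain l where l: "l \<in> \<Lambda>" "h l = h (scale q v)" using hL u hs by (metis imageE)
      \<comment> \<open>Injectivity of \<open>h\<close> is given on \<open>\<Lambda>\<close>, so
        both sides are first multiplied into the lattice.\<close>
      obtain N :: nat where N: "N > 0" "scale (of_nat N) (scale q v) \<in> \<Lambda>" using multiple_in_lattice by blast
      have "h (scale (of_nat N) l) = h (scale (of_nat N) (scale q v))" using l by (simp only: hs)
      then have "scale (of_nat N) l = scale (of_nat N) (scale q v)"
        by (rule inj_onD[OF inj]) (use l N in blast)+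
      then have "l = scale q v" using N(1) by (simp del: scale_scale)
      then have "scale q v \<in> \<Lambda>" using l(1) by simp
      then show "q \<in> \<int>" by (rule primitive_scaleD[OF prim])
    qed
    have "B u ` \<Lambda> = B v ` \<Lambda>" by (subst hL[symmetric]) (simp add: image_image u hB)
    then have "divisibility u = divisibility v"
      using divisibility[OF vL] by (intro divisibility_eqI) auto
    then have "star u = h (star v)" by (simp add: star_def hs u)
    moreover have "h (star v) - star v \<in> \<Lambda>" using h star_dual[OF vL] by (simp add: discriminant_isometry_def)
    ultimately have cls: "disc_class (star u) = disc_class (star v)" by (metis disc_class_eq_iff)
    \<comment> \<open>Splitting depends only on the class, so no summand has to be transported by
      \<open>h\<close>.\<close>
    then have "splitting_vector u"
      using splitting_vector_iff[OF primu] splitting_vector_iff[OF prim] v by simp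
    then show "u \<in> {u. splitting_vector u \<and> disc_class (star u) = disc_class (star v)}" using cls by simp
  }
  {
    fix u assume "u \<in> {u. splitting_vector u \<and> disc_class (star u) = disc_class (star v)}"
    then have primu: "primitive u" and cls: "disc_class (star v) = disc_class (star u)"
      by (auto simp: splitting_vector_def)
    note uL = primitive_nonzero[OF primu]
    \<comment> \<open>Equal classes have equal orders, so an isometry matching the two stars also
      matches \<open>v\<close> and \<open>u\<close>.\<close>
    have div: "divisibility u = divisibility v" using ord_star[OF primu] ord_star[OF prim] cls by simp
    obtain h where h: "discriminant_isometry h" "h (star v) = star u"
      using congruent_unimodular_isometric[of "star v" "star u"] star_dual star_unimodular vL uL cls disc_class_eq_iff
      by metis
    have "h v = h (scale (of_nat (divisibility v)) (star v))" using scale_divisibility_star[OF vL] by simp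
    also have "\<dots> = scale (of_nat (divisibility v)) (star u)"
      using h by (simp add: discriminant_isometry_def linear_iff_additive_homogeneous)
    also have "\<dots> = u" using scale_divisibility_star[OF uL] div by simp
    finally have "u = restrict h \<Lambda> v" using vL by simp
    then show "u \<in> orbit Gamma_group (\<lambda>\<gamma> v. \<gamma> v) v"
      using h(1) unfolding orbit_def carrier_Gamma by blast
  }
qed

text \<open>Each orbit is a full fibre of the class map on splitting vectors, which gives
  well-definedness and injectivity; surjectivity combines \<open>dual_class_primitive\<close> with
  \<open>splitting_vector_iff\<close>.\<close>

theorem orbits_bij_splitting_elements:
  "\<exists>F. bij_betw F (orbits Gamma_group {v. splitting_vector v} (\<lambda>\<gamma> v. \<gamma> v)) {X. splitting_element X} \<and>
     (\<forall>v. splitting_vector v \<longrightarrow> F (orbit Gamma_group (\<lambda>\<gamma> v. \<gamma> v) v) = disc_class (star v))"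
proof -
  let ?orb = "orbit Gamma_group (\<lambda>\<gamma> v. \<gamma> v)"
  \<comment> \<open>The class of the star is constant on an orbit, so its image there is a singleton
    and \<open>the_elem\<close> is meaningful.\<close>
  define F where "F = (\<lambda>A. the_elem ((\<lambda>v. disc_class (star v)) ` A))"
  have F: "F (?orb v) = disc_class (star v)" if v: "splitting_vector v" for v
  proof -
    have "(\<lambda>u. disc_class (star u)) ` ?orb v = {disc_class (star v)}"
      unfolding orbit_splitting_vector[OF v] using v by auto
    then show ?thesis by (simp add: F_def)
  qed
  have "bij_betw F (orbits Gamma_group {v. splitting_vector v} (\<lambda>\<gamma> v. \<gamma> v)) {X. splitting_element X}"
  proof (rule bij_betw_imageI)
    show "inj_on F (orbits Gamma_group {v. splitting_vector v} (\<lambda>\<gamma> v. \<gamma> v))"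
    proof (rule inj_onI)
      fix P Q
      assume PQ: "P \<in> orbits Gamma_group {v. splitting_vector v} (\<lambda>\<gamma> v. \<gamma> v)"
        "Q \<in> orbits Gamma_group {v. splitting_vector v} (\<lambda>\<gamma> v. \<gamma> v)" "F P = F Q"
      then obtain u v where "splitting_vector u" "P = ?orb u" "splitting_vector v" "Q = ?orb v"
        by (auto simp: orbits_def)
      then show "P = Q" using PQ(3) F orbit_splitting_vector by simp
    qed
    show "F ` orbits Gamma_group {v. splitting_vector v} (\<lambda>\<gamma> v. \<gamma> v) = {X. splitting_element X}"
    proof (intro equalityI subsetI)
      fix X assume "X \<in> F ` orbits Gamma_group {v. splitting_vector v} (\<lambda>\<gamma> v. \<gamma> v)"
      then obtain v where "splitting_vector v" "X = disc_class (star v)" by (auto simp: orbits_def F)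
      then show "X \<in> {X. splitting_element X}"
        using splitting_vector_iff[of v] by (auto simp: splitting_vector_def)
    next
      fix X assume "X \<in> {X. splitting_element X}"
      moreover from this obtain x where "x \<in> dual" "X = disc_class x"
        by (auto simp: splitting_element_def carrier_disc)
      ultimately obtain v where "splitting_vector v" "X = disc_class (star v)"
        using dual_class_primitive splitting_vector_iff by (metis mem_Collect_eq)
      then have "X = F (?orb v)" "?orb v \<in> orbits Gamma_group {v. splitting_vector v} (\<lambda>\<gamma> v. \<gamma> v)"
        unfolding orbits_def using F by blast+
      then show "X \<in> F ` orbits Gamma_group {v. splitting_vector v} (\<lambda>\<gamma> v. \<gamma> v)" by (rule image_eqI)
    qed
  qed
  then show ?thesis using F by blast
qed

end

end

theorem theorem3p2:
  fixes scale :: "rat \<Rightarrow> 'v::ab_group_add \<Rightarrow> 'v"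
    and \<Lambda> :: "'v set" and B :: "'v \<Rightarrow> 'v \<Rightarrow> rat" and g :: nat and ds :: "nat list"
  assumes "symplectic_lattice scale \<Lambda> B g"
    and "symplectic_lattice.has_type scale \<Lambda> B g ds"
    and "g \<ge> 2" and "ds ! 0 = 1" and "ds ! 1 = 1"
  shows
    "(\<forall>v. symplectic_lattice.primitive scale \<Lambda> v \<longrightarrow>
        (symplectic_lattice.splitting_vector scale \<Lambda> B v \<longleftrightarrow>
         symplectic_lattice.splitting_element \<Lambda> B
           (symplectic_lattice.disc_class \<Lambda> B (symplectic_lattice.star scale \<Lambda> B v)))) \<and>
     (\<exists>F. bij_betw F
            (orbits (symplectic_lattice.Gamma_group scale \<Lambda> B)
               {v. symplectic_lattice.splitting_vector scale \<Lambda> B v} (\<lambda>\<gamma> v. \<gamma> v))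
            {X. symplectic_lattice.splitting_element \<Lambda> B X} \<and>
          (\<forall>v. symplectic_lattice.splitting_vector scale \<Lambda> B v \<longrightarrow>
             F (orbit (symplectic_lattice.Gamma_group scale \<Lambda> B) (\<lambda>\<gamma> v. \<gamma> v) v) =
             symplectic_lattice.disc_class \<Lambda> B (symplectic_lattice.star scale \<Lambda> B v)))"
proof -
  interpret symplectic_lattice scale \<Lambda> B g by fact
  obtain e f where span_ef: "Z.span (e ` {..<g} \<union> f ` {..<g}) = \<Lambda>"
    and gram: "\<forall>i<g. \<forall>j<g. B (e i) (e j) = 0 \<and> B (f i) (f j) = 0 \<and>
      B (e i) (f j) = (if i = j then of_nat (ds ! i) else 0)"
    using assms(2) unfolding has_type_def by blast
  have "e i \<in> \<Lambda>" "f i \<in> \<Lambda>" if "i < g" for i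
    unfolding span_ef[symmetric] using that by (auto intro: Z.span_base)
  then have in_lattice: "e 0 \<in> \<Lambda>" "f 0 \<in> \<Lambda>" "e 1 \<in> \<Lambda>" "f 1 \<in> \<Lambda>"
    using assms(3) by simp_all
  have lt: "0 < g" "1 < g" using assms(3) by simp_all
  \<comment> \<open>As the first two entries of \<open>ds\<close> are 1, the first two pairs of
    basis vectors span orthogonal unimodular planes.\<close>
  have gram01: "B (e 0) (f 0) = 1" "B (e 1) (f 1) = 1" "B (e 0) (e 1) = 0" "B (e 0) (f 1) = 0"
    "B (f 0) (f 1) = 0" "B (e 1) (f 0) = 0"
    using gram[rule_format, OF lt(1) lt(1)] gram[rule_format, OF lt(2) lt(2)]
      gram[rule_format, OF lt] gram[rule_format, OF lt(2) lt(1)] assms(4,5) by simp_all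
  have "B (f 0) (e 1) = 0" using gram01(6) B_skew[of "f 0" "e 1"] by simp
  then show ?thesis
    using gram01 by (intro conjI allI impI splitting_vector_iff
      orbits_bij_splitting_elements[OF in_lattice])
qed

end
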